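(* Let $F_j$ be the Fibonacci numbers ($F_1=F_2=1$) and $I_n(x)=\prod_{i=1}^n\left(1+x^{F_{i+1}}\right)=\sum_k c_n(k)x^k$ for $n\ge0$. For integers $m\ge1$ and $0\le a<m$, let $h_{m,a}(n)$ be the number of integers $0\le k\le\deg I_n(x)$ with $c_n(k)\equiv a\pmod m$. Then $H_{m,a}(x)=\sum_{n\ge0}h_{m,a}(n)x^n$ is a rational function of $x$. *)

theory Defs
  imports "HOL-Computational_Algebra.Polynomial_FPS" "HOL-Number_Theory.Fib" "HOL-Number_Theory.Cong"
begin

definition fib_prod :: "nat \<Rightarrow> int poly" where
  "fib_prod n = (\<Prod>i=1..n. 1 + monom 1 (fib (i + 1)))"

definition fib_prod_count :: "int \<Rightarrow> int \<Rightarrow> nat \<Rightarrow> nat" where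
  "fib_prod_count m a n = card {k. k \<le> degree (fib_prod n) \<and> [coeff (fib_prod n) k = a] (mod m)}"

definition fib_prod_count_fps :: "int \<Rightarrow> int \<Rightarrow> rat fps" where
  "fib_prod_count_fps m a = Abs_fps (\<lambda>n. of_nat (fib_prod_count m a n))"

text \<open>A formal power series is a rational function if it is the expansion at 0 of a quotient
  of polynomials. Requiring a nonzero constant term of the denominator loses no generality for a
  power series (common powers of the variable cancel), and makes the quotient of
  formal power series the genuine one.\<close>

definition fps_rational_function :: "'a :: field fps \<Rightarrow> bool" where
  "fps_rational_function F \<longleftrightarrow>
     (\<exists>p q :: 'a poly. coeff q 0 \<noteq> 0 \<and> F = fps_of_poly p / fps_of_poly q)"

end

theory Submission imports Defs begin

text \<open>Cut the interval \<open>{0..deg I\<^sub>n}\<close> at \<open>F\<^sub>n\<^sub>+\<^sub>1\<close> and \<open>F\<^sub>n\<^sub>+\<^sub>2\<close> and record, for \<open>r < F\<^sub>n\<^sub>+\<^sub>1\<close>, the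
  triple \<open>(c\<^sub>n(r), c\<^sub>n(r + F\<^sub>n\<^sub>+\<^sub>1), c\<^sub>n(r + F\<^sub>n\<^sub>+\<^sub>2))\<close>. If \<open>r < F\<^sub>n\<close>, then this triple is
  \<open>(A, A + C, B)\<close>, where \<open>(A, B, C)\<close> is the triple of \<open>r\<close> at \<open>n - 1\<close>; if \<open>r = F\<^sub>n + s\<close> with
  \<open>s < F\<^sub>n\<^sub>-\<^sub>1\<close>, it is \<open>(A + C, A + C, C)\<close>, where \<open>(A, B, C)\<close> is the triple of \<open>s\<close> at \<open>n - 2\<close>.
  So the numbers of \<open>r\<close> with a prescribed triple modulo \<open>m\<close> satisfy a finite system of linear
  recurrences with constant coefficients. Their generating functions solve a linear system that
  is the identity modulo \<open>x\<close>, hence they are rational, and \<open>H\<^sub>m\<^sub>,\<^sub>a\<close> is built from them.\<close>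

section \<open>Rational power series\<close>

text \<open>A nonzero constant term makes the denominator a unit, so it can be cleared. The closure
  proofs below then reduce to polynomial identities.\<close>

lemma fps_rational_function_iff:
  "fps_rational_function (F :: 'a :: field fps) \<longleftrightarrow>
     (\<exists>p q. coeff q 0 \<noteq> 0 \<and> F * fps_of_poly q = fps_of_poly p)"
proof -
  have "F = fps_of_poly p / fps_of_poly q \<longleftrightarrow> F * fps_of_poly q = fps_of_poly p"
    if "coeff q 0 \<noteq> 0" for p q :: "'a poly"
  proof -
    have nz: "fps_nth (fps_of_poly q) 0 \<noteq> 0"
      using that by simp
    have inv: "fps_of_poly q * inverse (fps_of_poly q) = 1"
      using inverse_mult_eq_1[OF nz] by (simp add: mult.commute)
    show ?thesis
    proof
      assume "F = fps_of_poly p / fps_of_poly q"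
      then have "F * fps_of_poly q = fps_of_poly p * (fps_of_poly q * inverse (fps_of_poly q))"
        by (simp only: fps_divide_unit[OF nz] ac_simps)
      then show "F * fps_of_poly q = fps_of_poly p"
        by (simp only: inv mult_1_right)
    next
      assume "F * fps_of_poly q = fps_of_poly p"
      then have "fps_of_poly p / fps_of_poly q = F * (fps_of_poly q * inverse (fps_of_poly q))"
        by (simp only: fps_divide_unit[OF nz] mult.assoc[symmetric])
      then show "F = fps_of_poly p / fps_of_poly q"
        by (simp only: inv mult_1_right)
    qed
  qed
  then show ?thesis
    unfolding fps_rational_function_def by blast
qed

lemma fps_rational_function_of_poly [simp]: "fps_rational_function (fps_of_poly p)"
  unfolding fps_rational_function_iff by (rule exI[of _ p], rule exI[of _ 1]) simp

lemma fps_rational_function_const [simp]: "fps_rational_function (fps_const c)"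
  using fps_rational_function_of_poly[of "[:c:]"] by (simp add: fps_of_poly_const)

lemma fps_rational_function_0 [simp]: "fps_rational_function 0"
  using fps_rational_function_const[of 0] by simp

lemma fps_rational_function_1 [simp]: "fps_rational_function 1"
  using fps_rational_function_const[of 1] by simp

lemma fps_rational_function_X [simp]: "fps_rational_function (fps_X :: 'a :: field fps)"
  using fps_rational_function_of_poly[of "monom (1 :: 'a) 1"] by (simp add: fps_of_poly_monom)

lemma fps_rational_function_add:
  assumes "fps_rational_function F" "fps_rational_function G"
  shows "fps_rational_function (F + G)"
proof -
  obtain p q p' q' where *: "coeff q 0 \<noteq> 0" "F * fps_of_poly q = fps_of_poly p"
    "coeff q' 0 \<noteq> 0" "G * fps_of_poly q' = fps_of_poly p'"
    using assms unfolding fps_rational_function_iff by blast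
  have "(F + G) * fps_of_poly (q * q')
      = (F * fps_of_poly q) * fps_of_poly q' + (G * fps_of_poly q') * fps_of_poly q"
    by (simp add: fps_of_poly_mult algebra_simps)
  also have "\<dots> = fps_of_poly (p * q' + p' * q)"
    by (simp add: * fps_of_poly_mult fps_of_poly_add)
  finally show ?thesis
    unfolding fps_rational_function_iff using *
    by (intro exI[of _ "p * q' + p' * q"] exI[of _ "q * q'"]) (simp add: coeff_mult)
qed

lemma fps_rational_function_mult:
  assumes "fps_rational_function F" "fps_rational_function G"
  shows "fps_rational_function (F * G)"
proof -
  obtain p q p' q' where *: "coeff q 0 \<noteq> 0" "F * fps_of_poly q = fps_of_poly p"
    "coeff q' 0 \<noteq> 0" "G * fps_of_poly q' = fps_of_poly p'"
    using assms unfolding fps_rational_function_iff by blast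
  have "(F * G) * fps_of_poly (q * q') = (F * fps_of_poly q) * (G * fps_of_poly q')"
    by (simp add: fps_of_poly_mult algebra_simps)
  also have "\<dots> = fps_of_poly (p * p')"
    by (simp add: * fps_of_poly_mult)
  finally show ?thesis
    unfolding fps_rational_function_iff using *
    by (intro exI[of _ "p * p'"] exI[of _ "q * q'"]) (simp add: coeff_mult)
qed

lemma fps_rational_function_uminus:
  "fps_rational_function F \<Longrightarrow> fps_rational_function (- F)"
  unfolding fps_rational_function_iff
  by (metis fps_of_poly_uminus mult_minus_left)

lemma fps_rational_function_diff:
  "fps_rational_function F \<Longrightarrow> fps_rational_function G \<Longrightarrow> fps_rational_function (F - G)"
  using fps_rational_function_add[of F "- G"] fps_rational_function_uminus[of G] by simp

lemma fps_rational_function_sum: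
  "(\<And>i. i \<in> S \<Longrightarrow> fps_rational_function (F i)) \<Longrightarrow> fps_rational_function (\<Sum>i\<in>S. F i)"
  by (induction S rule: infinite_finite_induct) (auto intro: fps_rational_function_add)

text \<open>Numerator and denominator swap roles; \<open>p\<close> may serve as denominator because
  its constant term is the product of those of \<open>F\<close> and \<open>q\<close>.\<close>

lemma fps_rational_function_inverse:
  assumes "fps_rational_function F" "fps_nth F 0 \<noteq> 0"
  shows "fps_rational_function (inverse F)"
proof -
  obtain p q where *: "coeff q 0 \<noteq> 0" "F * fps_of_poly q = fps_of_poly p"
    using assms unfolding fps_rational_function_iff by blast
  have "coeff p 0 = fps_nth (F * fps_of_poly q) 0"
    unfolding *(2) by simp
  also have "\<dots> \<noteq> 0"
    using *(1) assms(2) by simp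
  finally have "coeff p 0 \<noteq> 0" .
  moreover have "inverse F * fps_of_poly p = fps_of_poly q"
    using inverse_mult_eq_1[OF assms(2)] *(2) by (metis mult.assoc mult.left_neutral)
  ultimately show ?thesis
    unfolding fps_rational_function_iff by blast
qed

lemmas fps_rational_function_intros =
  fps_rational_function_add fps_rational_function_mult fps_rational_function_diff
  fps_rational_function_sum fps_rational_function_inverse

text \<open>Gaussian elimination: every pivot \<open>1 - X * M u u\<close> is a unit of the ring of power series.\<close>

lemma fps_rational_function_linear_system:
  fixes F P :: "'b \<Rightarrow> 'a :: field fps"
  assumes "finite S"
    and "\<And>v. v \<in> S \<Longrightarrow> fps_rational_function (P v)"
    and "\<And>v w. v \<in> S \<Longrightarrow> w \<in> S \<Longrightarrow> fps_rational_function (M v w)"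
    and "\<And>v. v \<in> S \<Longrightarrow> F v = P v + fps_X * (\<Sum>w\<in>S. M v w * F w)"
    and "v \<in> S"
  shows "fps_rational_function (F v)"
  using assms
proof (induction S arbitrary: P M v rule: finite_induct)
  case empty
  then show ?case by simp
next
  case (insert u S)
  note P = insert.prems(1) and M = insert.prems(2) and F = insert.prems(3)
  define D where "D = inverse (1 - fps_X * M u u)"
  have D_inv: "D * (1 - fps_X * M u u) = 1"
    unfolding D_def by (rule inverse_mult_eq_1) simp
  have D: "fps_rational_function D"
    unfolding D_def using M by (intro fps_rational_function_intros) auto
  have "(1 - fps_X * M u u) * F u = P u + fps_X * (\<Sum>w\<in>S. M u w * F w)"
    using F[of u] insert.hyps by (simp add: algebra_simps)
  then have "D * ((1 - fps_X * M u u) * F u) = D * (P u + fps_X * (\<Sum>w\<in>S. M u w * F w))"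
    by simp
  then have Fu: "F u = D * (P u + fps_X * (\<Sum>w\<in>S. M u w * F w))"
    by (simp add: mult.assoc[symmetric] D_inv)
  \<comment> \<open>These come from substituting the solved equation for \<open>F u\<close> into the
    others. The factor \<open>fps_X\<close> in front of the sum survives, so the smaller system has
    the same shape.\<close>
  define P' where "P' v = P v + fps_X * M v u * D * P u" for v
  define M' where "M' v w = M v w + fps_X * M v u * D * M u w" for v w
  have rec: "F v = P' v + fps_X * (\<Sum>w\<in>S. M' v w * F w)" if "v \<in> S" for v
  proof -
    have "F v = P v + fps_X * (M v u * F u + (\<Sum>w\<in>S. M v w * F w))"
      using F[of v] that insert.hyps by simp
    also have "\<dots> = P' v + fps_X * ((\<Sum>w\<in>S. M v w * F w)
        + (fps_X * M v u * D) * (\<Sum>w\<in>S. M u w * F w))"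
      unfolding Fu P'_def by (simp add: algebra_simps)
    also have "(\<Sum>w\<in>S. M v w * F w) + (fps_X * M v u * D) * (\<Sum>w\<in>S. M u w * F w)
        = (\<Sum>w\<in>S. M' v w * F w)"
      unfolding M'_def by (simp add: sum_distrib_left sum.distrib distrib_right mult.assoc)
    finally show ?thesis .
  qed
  have S: "fps_rational_function (F w)" if "w \<in> S" for w
  proof (rule insert.IH[of P' M', OF _ _ rec that])
    show "fps_rational_function (P' v)" if "v \<in> S" for v
      unfolding P'_def using that P M D by (intro fps_rational_function_intros) auto
    show "fps_rational_function (M' v w)" if "v \<in> S" "w \<in> S" for v w
      unfolding M'_def using that P M D by (intro fps_rational_function_intros) auto
  qed
  have "fps_rational_function (F u)"
    unfolding Fu using P M D S by (intro fps_rational_function_intros) auto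
  with S insert.prems(4) show ?case
    by blast
qed

section \<open>Coefficients of the Fibonacci product\<close>

lemma fib_prod_0 [simp]: "fib_prod 0 = 1"
  by (simp add: fib_prod_def)

lemma fib_prod_Suc: "fib_prod (Suc n) = fib_prod n + monom 1 (fib (n + 2)) * fib_prod n"
  by (simp add: fib_prod_def algebra_simps)

lemma coeff_fib_prod_Suc:
  "coeff (fib_prod (Suc n)) k =
     coeff (fib_prod n) k + (if k < fib (n + 2) then 0 else coeff (fib_prod n) (k - fib (n + 2)))"
  by (simp add: fib_prod_Suc coeff_monom_mult)

lemma coeff_fib_prod_0 [simp]: "coeff (fib_prod n) 0 = 1"
  by (induction n) (simp_all add: coeff_fib_prod_Suc fib_neq_0_nat)

text \<open>Degrees of the factors add up, and each new one, \<open>fib (n + 2)\<close>, is the gap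
  between consecutive right-hand sides.\<close>

lemma degree_fib_prod: "degree (fib_prod n) + 2 = fib (n + 3)"
proof (induction n)
  case 0
  then show ?case by (simp add: numeral_3_eq_3)
next
  case (Suc n)
  let ?q = "1 + monom 1 (fib (n + 2)) :: int poly"
  have "fib (n + 2) > 0"
    by (simp add: fib_neq_0_nat)
  then have deg: "degree ?q = fib (n + 2)"
    by (subst degree_add_eq_right) (simp_all add: degree_monom_eq)
  have "?q \<noteq> 0"
    using deg \<open>fib (n + 2) > 0\<close> by (metis degree_0 less_irrefl)
  moreover have "fib_prod n \<noteq> 0"
    using coeff_fib_prod_0[of n] by (metis coeff_0 zero_neq_one)
  moreover have "fib_prod (Suc n) = fib_prod n * ?q"
    by (simp add: fib_prod_Suc algebra_simps)
  ultimately have "degree (fib_prod (Suc n)) = degree (fib_prod n) + fib (n + 2)"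
    using deg by (simp add: degree_mult_eq del: fib.simps)
  with Suc show ?case
    by (simp add: numeral_3_eq_3)
qed

lemma coeff_fib_prod_eq_0: "fib (n + 3) \<le> k + 1 \<Longrightarrow> coeff (fib_prod n) k = 0"
  using degree_fib_prod[of n] by (intro coeff_eq_0) linarith

section \<open>Residue triples\<close>

text \<open>Multiplying by the next factor adds a copy shifted by \<open>fib (n + 2)\<close>. With
  these offsets, the entries at the next level again depend only on the triple. Reduction modulo
  \<open>m\<close> leaves finitely many values.\<close>

definition fib_triple :: "int \<Rightarrow> nat \<Rightarrow> nat \<Rightarrow> int \<times> int \<times> int" where
  "fib_triple m n r =
     (coeff (fib_prod n) r mod m,
      coeff (fib_prod n) (r + fib (n + 1)) mod m,
      coeff (fib_prod n) (r + fib (n + 2)) mod m)"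

definition triple_step1 :: "int \<Rightarrow> int \<times> int \<times> int \<Rightarrow> int \<times> int \<times> int" where
  "triple_step1 m = (\<lambda>(A, B, C). (A, (A + C) mod m, B))"

definition triple_step2 :: "int \<Rightarrow> int \<times> int \<times> int \<Rightarrow> int \<times> int \<times> int" where
  "triple_step2 m = (\<lambda>(A, B, C). ((A + C) mod m, (A + C) mod m, C))"

text \<open>The first position lies below the shift \<open>fib (n + 2)\<close>, so only the old copy
  contributes; the last exceeds the old degree, so only the shifted copy does. In between both
  contribute.\<close>

lemma coeff_fib_prod_Suc_low:
  assumes "r < fib (n + 1)"
  shows "coeff (fib_prod (Suc n)) r = coeff (fib_prod n) r"
    and "coeff (fib_prod (Suc n)) (r + fib (n + 2)) =
      coeff (fib_prod n) r + coeff (fib_prod n) (r + fib (n + 2))"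
    and "coeff (fib_prod (Suc n)) (r + fib (n + 3)) = coeff (fib_prod n) (r + fib (n + 1))"
proof -
  have F: "fib (n + 3) = fib (n + 2) + fib (n + 1)"
    by (simp add: numeral_3_eq_3)
  have "fib (n + 1) \<le> fib (n + 2)"
    by (rule fib_mono) simp
  with assms show "coeff (fib_prod (Suc n)) r = coeff (fib_prod n) r"
    by (simp add: coeff_fib_prod_Suc del: fib.simps)
  show "coeff (fib_prod (Suc n)) (r + fib (n + 2)) =
      coeff (fib_prod n) r + coeff (fib_prod n) (r + fib (n + 2))"
    by (simp add: coeff_fib_prod_Suc)
  have "coeff (fib_prod n) (r + fib (n + 3)) = 0"
    by (rule coeff_fib_prod_eq_0) simp
  then show "coeff (fib_prod (Suc n)) (r + fib (n + 3)) = coeff (fib_prod n) (r + fib (n + 1))"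
    by (simp add: coeff_fib_prod_Suc F)
qed

text \<open>The first two positions both reduce to position \<open>fib (n + 2) + s\<close> at level
  \<open>Suc n\<close>, where the two copies of level \<open>n\<close> overlap. The third reduces to
  \<open>fib (n + 2) + s + fib (n + 2)\<close> there.\<close>

lemma coeff_fib_prod_Suc_Suc_high:
  assumes "s < fib (n + 1)"
  shows "coeff (fib_prod (Suc (Suc n))) (fib (n + 2) + s) =
      coeff (fib_prod n) s + coeff (fib_prod n) (s + fib (n + 2))"
    and "coeff (fib_prod (Suc (Suc n))) (fib (n + 2) + s + fib (n + 3)) =
      coeff (fib_prod n) s + coeff (fib_prod n) (s + fib (n + 2))"
    and "coeff (fib_prod (Suc (Suc n))) (fib (n + 2) + s + fib (n + 4)) =
      coeff (fib_prod n) (s + fib (n + 2))"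
proof -
  have F3: "fib (n + 3) = fib (n + 2) + fib (n + 1)"
    and F4: "fib (n + 4) = fib (n + 3) + fib (n + 2)"
    by (simp_all add: numeral_3_eq_3 numeral_eq_Suc)
  have step: "coeff (fib_prod (Suc (Suc n))) k =
     coeff (fib_prod (Suc n)) k +
     (if k < fib (n + 3) then 0 else coeff (fib_prod (Suc n)) (k - fib (n + 3)))" for k
    using coeff_fib_prod_Suc[of "Suc n" k] by (simp add: numeral_3_eq_3 del: fib.simps)
  have zero: "coeff (fib_prod (Suc n)) k = 0" if "fib (n + 4) \<le> k + 1" for k
    using coeff_fib_prod_eq_0[of "Suc n" k] that by (simp add: numeral_eq_Suc del: fib.simps)
  have zero': "coeff (fib_prod n) k = 0" if "fib (n + 3) \<le> k + 1" for k
    using coeff_fib_prod_eq_0 that .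
  note mid = coeff_fib_prod_Suc_low(2)[OF assms]
  show "coeff (fib_prod (Suc (Suc n))) (fib (n + 2) + s) =
      coeff (fib_prod n) s + coeff (fib_prod n) (s + fib (n + 2))"
    using assms mid by (simp add: step F3 add.commute del: fib.simps)
  show "coeff (fib_prod (Suc (Suc n))) (fib (n + 2) + s + fib (n + 3)) =
      coeff (fib_prod n) s + coeff (fib_prod n) (s + fib (n + 2))"
    using assms mid zero[of "fib (n + 2) + s + fib (n + 3)"]
    by (simp add: step F4 add.commute del: fib.simps)
  have "coeff (fib_prod (Suc (Suc n))) (fib (n + 2) + s + fib (n + 4)) =
      coeff (fib_prod (Suc n)) (fib (n + 2) + s + fib (n + 2))"
    using zero[of "fib (n + 2) + s + fib (n + 4)"] by (simp add: step F4 add.assoc del: fib.simps)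
  also have "\<dots> = coeff (fib_prod n) (s + fib (n + 2))"
  proof -
    \<comment> \<open>Hence \<open>2 * fib (n + 2)\<close> is at least \<open>fib (n + 3)\<close>,
      so the unshifted copy contributes nothing.\<close>
    have "fib (n + 1) \<le> fib (n + 2)"
      by (rule fib_mono) simp
    then show ?thesis
      using zero'[of "fib (n + 2) + s + fib (n + 2)"]
      by (simp add: coeff_fib_prod_Suc F3 add.commute del: fib.simps)
  qed
  finally show "coeff (fib_prod (Suc (Suc n))) (fib (n + 2) + s + fib (n + 4)) =
      coeff (fib_prod n) (s + fib (n + 2))" .
qed

lemma fib_triple_Suc:
  assumes "r < fib (n + 1)"
  shows "fib_triple m (Suc n) r = triple_step1 m (fib_triple m n r)"
proof -
  have idx: "Suc n + 1 = n + 2" "Suc n + 2 = n + 3" by simp_all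
  show ?thesis
    unfolding fib_triple_def triple_step1_def
    by (simp only: coeff_fib_prod_Suc_low[OF assms] prod.case mod_add_eq idx)
qed

lemma fib_triple_Suc_Suc:
  assumes "s < fib (n + 1)"
  shows "fib_triple m (Suc (Suc n)) (fib (n + 2) + s) = triple_step2 m (fib_triple m n s)"
proof -
  have idx: "Suc (Suc n) + 1 = n + 3" "Suc (Suc n) + 2 = n + 4" by simp_all
  show ?thesis
    unfolding fib_triple_def triple_step2_def
    by (simp only: coeff_fib_prod_Suc_Suc_high[OF assms] prod.case mod_add_eq idx)
qed

section \<open>Counting positions by their residue triple\<close>

definition triple_count :: "int \<Rightarrow> (int \<times> int \<times> int \<Rightarrow> bool) \<Rightarrow> nat \<Rightarrow> nat" where
  "triple_count m Q n = card {r. r < fib (n + 1) \<and> Q (fib_triple m n r)}"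

definition residue_triples :: "int \<Rightarrow> (int \<times> int \<times> int) set" where
  "residue_triples m = {0..<m} \<times> {0..<m} \<times> {0..<m}"

lemma finite_residue_triples [simp]: "finite (residue_triples m)"
  by (simp add: residue_triples_def)

lemma fib_triple_in_residue_triples: "m \<ge> 1 \<Longrightarrow> fib_triple m n r \<in> residue_triples m"
  by (simp add: fib_triple_def residue_triples_def)

lemma card_less_add:
  "card {r. r < a + b \<and> P r} = card {r. r < a \<and> P r} + card {s. s < b \<and> P (a + s)}"
  for a b :: nat
proof -
  have eq: "{r. r < a + b \<and> P r} = {r. r < a \<and> P r} \<union> (+) a ` {s. s < b \<and> P (a + s)}"
  proof (intro equalityI subsetI)
    fix r assume "r \<in> {r. r < a + b \<and> P r}"
    then show "r \<in> {r. r < a \<and> P r} \<union> (+) a ` {s. s < b \<and> P (a + s)}"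
      by (cases "r < a") (auto intro!: image_eqI[of _ _ "r - a"])
  qed auto
  show ?thesis
    unfolding eq by (subst card_Un_disjoint) (auto simp: card_image)
qed

text \<open>The range of positions splits at \<open>fib (n + 2)\<close>, and each half is governed
  by one step map. Arbitrary predicates \<open>Q\<close> are allowed so that the preimage of a
  condition under a step is again such a condition.\<close>

lemma triple_count_rec:
  "triple_count m Q (Suc (Suc n)) =
     triple_count m (\<lambda>w. Q (triple_step1 m w)) (Suc n) +
     triple_count m (\<lambda>w. Q (triple_step2 m w)) n"
proof -
  have F: "fib (Suc (Suc n) + 1) = fib (n + 2) + fib (n + 1)"
    by simp
  have 1: "fib_triple m (Suc (Suc n)) r = triple_step1 m (fib_triple m (Suc n) r)"
    if "r < fib (n + 2)" for r
    using that by (intro fib_triple_Suc) (simp del: fib.simps)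
  have "{r. r < fib (n + 2) \<and> Q (fib_triple m (Suc (Suc n)) r)}
      = {r. r < fib (Suc n + 1) \<and> Q (triple_step1 m (fib_triple m (Suc n) r))}"
    using 1 by (auto simp del: fib.simps)
  moreover have "{s. s < fib (n + 1) \<and> Q (fib_triple m (Suc (Suc n)) (fib (n + 2) + s))}
      = {s. s < fib (n + 1) \<and> Q (triple_step2 m (fib_triple m n s))}"
    using fib_triple_Suc_Suc by (auto simp del: fib.simps)
  ultimately show ?thesis
    unfolding triple_count_def F card_less_add by simp
qed

text \<open>Splitting by the exact value of the triple expresses every count through finitely many
  unknowns, those of the predicates \<open>(=) w\<close>.\<close>

lemma triple_count_eq_sum:
  assumes "m \<ge> 1"
  shows "triple_count m Q n =
    (\<Sum>w\<in>residue_triples m. if Q w then triple_count m ((=) w) n else 0)"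
proof -
  let ?S = "{w \<in> residue_triples m. Q w}"
  let ?A = "\<lambda>w. {r. r < fib (n + 1) \<and> w = fib_triple m n r}"
  have "{r. r < fib (n + 1) \<and> Q (fib_triple m n r)} = (\<Union>w\<in>?S. ?A w)"
    using fib_triple_in_residue_triples[OF assms] by auto
  also have "card \<dots> = (\<Sum>w\<in>?S. card (?A w))"
    by (rule card_UN_disjoint) (simp, simp, blast)
  finally show ?thesis
    unfolding triple_count_def by (simp only: sum.inter_filter finite_residue_triples)
qed

section \<open>Generating functions of the triple counts\<close>

definition triple_count_fps :: "int \<Rightarrow> (int \<times> int \<times> int \<Rightarrow> bool) \<Rightarrow> rat fps" where
  "triple_count_fps m Q = Abs_fps (\<lambda>n. of_nat (triple_count m Q n))"

lemma triple_count_fps_eq_sum: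
  assumes "m \<ge> 1"
  shows "triple_count_fps m Q =
    (\<Sum>w\<in>residue_triples m. fps_const (of_bool (Q w)) * triple_count_fps m ((=) w))"
  by (rule fps_ext)
     (simp add: triple_count_fps_def triple_count_eq_sum[OF assms, of Q] fps_sum_nth
        of_bool_def if_distrib[of of_nat] if_distrib[of "\<lambda>x. x * _"] cong: if_cong)

text \<open>The recurrence starts at index 2. The two explicit terms supply the coefficients at 0
  and 1, the latter reduced by what the shifted \<open>triple_step1\<close> series already puts
  there.\<close>

lemma triple_count_fps_rec:
  "triple_count_fps m Q =
     fps_const (of_nat (triple_count m Q 0))
     + fps_const (of_nat (triple_count m Q 1)
         - of_nat (triple_count m (\<lambda>w. Q (triple_step1 m w)) 0)) * fps_X
     + fps_X * triple_count_fps m (\<lambda>w. Q (triple_step1 m w))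
     + fps_X * (fps_X * triple_count_fps m (\<lambda>w. Q (triple_step2 m w)))"
  (is "_ = ?R")
proof (rule fps_ext)
  fix n
  consider "n = 0" | "n = 1" | k where "n = Suc (Suc k)"
    by (metis One_nat_def not0_implies_Suc)
  then show "fps_nth (triple_count_fps m Q) n = fps_nth ?R n"
    by cases (simp_all add: triple_count_fps_def triple_count_rec)
qed

lemma fps_rational_function_triple_count_fps:
  assumes "m \<ge> 1"
  shows "fps_rational_function (triple_count_fps m Q)"
proof -
  let ?S = "residue_triples m"
  let ?F = "\<lambda>v. triple_count_fps m ((=) v)"
  define P :: "int \<times> int \<times> int \<Rightarrow> rat fps" where
    "P v = fps_const (of_nat (triple_count m ((=) v) 0))
     + fps_const (of_nat (triple_count m ((=) v) 1)
         - of_nat (triple_count m (\<lambda>w. v = triple_step1 m w) 0)) * fps_X" for v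
  \<comment> \<open>One \<open>fps_X\<close> stands outside the sum in the linear system, so the
    one-level step enters with degree 0 and the two-level step with degree 1.\<close>
  define M :: "int \<times> int \<times> int \<Rightarrow> int \<times> int \<times> int \<Rightarrow> rat fps" where
    "M v w = fps_const (of_bool (v = triple_step1 m w))
      + fps_X * fps_const (of_bool (v = triple_step2 m w))" for v w
  have "fps_rational_function (?F v)" if "v \<in> ?S" for v
  proof (rule fps_rational_function_linear_system[of ?S P M ?F, OF _ _ _ _ that])
    show "fps_rational_function (P v)" for v
      unfolding P_def by (intro fps_rational_function_intros) auto
    show "fps_rational_function (M v w)" for v w
      unfolding M_def by (intro fps_rational_function_intros) auto
    show "?F v = P v + fps_X * (\<Sum>w\<in>?S. M v w * ?F w)" for v
    proof -
      have "(\<Sum>w\<in>?S. M v w * ?F w) = triple_count_fps m (\<lambda>w. v = triple_step1 m w)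
          + fps_X * triple_count_fps m (\<lambda>w. v = triple_step2 m w)"
        unfolding M_def triple_count_fps_eq_sum[OF assms, of "\<lambda>w. v = triple_step1 m w"]
          triple_count_fps_eq_sum[OF assms, of "\<lambda>w. v = triple_step2 m w"]
        by (simp only: distrib_right sum.distrib sum_distrib_left mult.assoc)
      then show ?thesis
        by (subst triple_count_fps_rec) (simp add: P_def distrib_left)
    qed
  qed simp
  then show ?thesis
    unfolding triple_count_fps_eq_sum[OF assms, of Q]
    by (intro fps_rational_function_intros) auto
qed

text \<open>The term \<open>of_bool (a = 0)\<close> accounts for \<open>r = F\<^sub>n\<^sub>+\<^sub>2 - 1\<close>, for which \<open>r + F\<^sub>n\<^sub>+\<^sub>3\<close> exceeds the degree
  of \<open>I\<^sub>n\<^sub>+\<^sub>1\<close> by one.\<close>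

lemma fib_prod_count_Suc:
  assumes "0 \<le> a" "a < m"
  shows "fib_prod_count m a (Suc n) + of_bool (a = 0) =
    triple_count m (\<lambda>(A, B, C). A = a) (Suc n) + triple_count m (\<lambda>(A, B, C). (A + C) mod m = a) n
    + triple_count m (\<lambda>(A, B, C). C = a) (Suc n)"
proof -
  let ?c = "\<lambda>k. coeff (fib_prod (Suc n)) k"
  let ?P = "\<lambda>k. ?c k mod m = a"
  have F3: "fib (n + 3) = fib (n + 2) + fib (n + 1)"
    and F4: "fib (n + 4) = fib (n + 3) + fib (n + 2)"
    by (simp_all add: numeral_3_eq_3 numeral_eq_Suc)
  have deg: "degree (fib_prod (Suc n)) + 2 = fib (n + 4)"
    using degree_fib_prod[of "Suc n"] by (simp add: numeral_eq_Suc del: fib.simps)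
  have cong: "[?c k = a] (mod m) \<longleftrightarrow> ?P k" for k
    using assms by (simp add: cong_def)
  have "?c (degree (fib_prod (Suc n)) + 1) = 0"
    by (rule coeff_eq_0) simp
  then have top: "?P (degree (fib_prod (Suc n)) + 1) \<longleftrightarrow> a = 0"
    by auto
  have top_set: "{s. s < 1 \<and> ?P (degree (fib_prod (Suc n)) + 1 + s)} = (if a = 0 then {0} else {})"
    using top by auto
  have "card {k. k < fib (n + 4) \<and> ?P k} =
      card {k. k < (degree (fib_prod (Suc n)) + 1) + 1 \<and> ?P k}"
    using deg by (simp add: numeral_2_eq_2 del: fib.simps)
  also have "\<dots> = card {k. k < degree (fib_prod (Suc n)) + 1 \<and> ?P k} + of_bool (a = 0)"
    unfolding card_less_add[of "degree (fib_prod (Suc n)) + 1"] top_set by simp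
  also have "card {k. k < degree (fib_prod (Suc n)) + 1 \<and> ?P k} = fib_prod_count m a (Suc n)"
    unfolding fib_prod_count_def cong by (simp add: less_Suc_eq_le)
  finally have "fib_prod_count m a (Suc n) + of_bool (a = 0) =
      card {k. k < fib (n + 2) + fib (n + 1) + fib (n + 2) \<and> ?P k}"
    unfolding F4 F3 by simp
  \<comment> \<open>The outer blocks have length \<open>fib (n + 2)\<close> and are read off the
    first and third entries at level \<open>Suc n\<close>. The middle block is shorter, and its
    coefficients are sums \<open>A + C\<close> from level \<open>n\<close>.\<close>
  also have "\<dots> = card {k. k < fib (n + 2) \<and> ?P k} + card {r. r < fib (n + 1) \<and> ?P (fib (n + 2) + r)}
      + card {r. r < fib (n + 2) \<and> ?P (fib (n + 3) + r)}"
    unfolding card_less_add F3 ..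
  also have "{k. k < fib (n + 2) \<and> ?P k} =
      {r. r < fib (Suc n + 1) \<and> (case fib_triple m (Suc n) r of (A, B, C) \<Rightarrow> A = a)}"
    by (simp add: fib_triple_def del: fib.simps)
  also have "{r. r < fib (n + 2) \<and> ?P (fib (n + 3) + r)} =
      {r. r < fib (Suc n + 1) \<and> (case fib_triple m (Suc n) r of (A, B, C) \<Rightarrow> C = a)}"
    by (simp add: fib_triple_def numeral_3_eq_3 add.commute del: fib.simps)
  also have "{r. r < fib (n + 1) \<and> ?P (fib (n + 2) + r)} =
      {r. r < fib (n + 1) \<and> (case fib_triple m n r of (A, B, C) \<Rightarrow> (A + C) mod m = a)}"
    using coeff_fib_prod_Suc_low(2)[of _ n]
    by (auto simp: fib_triple_def mod_add_eq add.commute simp del: fib.simps)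
  finally show ?thesis
    unfolding triple_count_def .
qed

theorem theorem8:
  fixes m a :: int
  assumes "m \<ge> 1" and "0 \<le> a" and "a < m"
  shows "fps_rational_function (fib_prod_count_fps m a)"
proof -
  let ?F1 = "triple_count_fps m (\<lambda>(A, B, C). A = a)"
  let ?F2 = "triple_count_fps m (\<lambda>(A, B, C). (A + C) mod m = a)"
  let ?F3 = "triple_count_fps m (\<lambda>(A, B, C). C = a)"
  \<comment> \<open>The correction \<open>of_bool (a = 0)\<close> occurs at every index, hence a
    geometric series.\<close>
  let ?G = "fps_const (of_bool (a = 0)) * inverse (1 - fps_X) :: rat fps"
  let ?R = "?F1 + fps_X * ?F2 + ?F3 - ?G"
  have G: "fps_nth ?G n = of_bool (a = 0)" for n
    by (simp add: fps_inverse_one_minus_fps_X)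
  \<comment> \<open>The counting identity covers only indices \<open>Suc n\<close>; the added
    constant repairs the coefficient at 0.\<close>
  have "fib_prod_count_fps m a =
      ?R + fps_const (of_nat (fib_prod_count m a 0) - fps_nth ?R 0)"
  proof (rule fps_ext)
    fix n
    show "fps_nth (fib_prod_count_fps m a) n =
      fps_nth (?R + fps_const (of_nat (fib_prod_count m a 0) - fps_nth ?R 0)) n"
    proof (cases n)
      case 0
      then show ?thesis by (simp add: fib_prod_count_fps_def)
    next
      case (Suc k)
      have "(of_nat (fib_prod_count m a n + of_bool (a = 0)) :: rat) =
          of_nat (triple_count m (\<lambda>(A, B, C). A = a) n
            + triple_count m (\<lambda>(A, B, C). (A + C) mod m = a) k
            + triple_count m (\<lambda>(A, B, C). C = a) n)"
        unfolding Suc fib_prod_count_Suc[OF assms(2,3)] ..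
      then have "of_nat (fib_prod_count m a n) =
          fps_nth ?F1 n + fps_nth ?F2 k + fps_nth ?F3 n - fps_nth ?G n"
        unfolding G triple_count_fps_def by (simp add: algebra_simps)
      then show ?thesis
        by (simp add: Suc fib_prod_count_fps_def)
    qed
  qed
  also have "fps_rational_function \<dots>"
    using fps_rational_function_triple_count_fps[OF assms(1)]
    by (intro fps_rational_function_intros) auto
  finally show ?thesis .
qed

end
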